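(* Let $\mathcal A\subset\mathcal K$ be two categories with $\mathcal A$ a full and reflective subcategory of $\mathcal K$. Let $R:\mathcal K\to\mathcal A$ be the reflection. Consider an adjunction $F\dashv G:\mathcal K\to\mathcal K$. Then the following conditions are equivalent: (i) $F(\mathcal A)\subset\mathcal A$ and $G(\mathcal A)\subset\mathcal A$. (ii) There is a natural isomorphism $R(F(X))\cong F(R(X))$ for every $X\in\mathcal K$. If one of the two preceding conditions is satisfied, the restriction of $F$ to $\mathcal A$ is left adjoint to the restriction of $G$ to $\mathcal A$.
   Context: All categories are locally small, and subcategories are always isomorphism-closed (replete). The reflection $R$ is the left adjoint of the inclusion $\mathcal A\subset\mathcal K$; in (ii), objects of $\mathcal A$ are regarded as objects of $\mathcal K$ via the inclusion. *)

theory Defs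
  imports "HOL-Library.FuncSet"
begin

text \<open>
  Categories are given by sets of objects and arrows inside arbitrary HOL types. In particular
  every hom is a HOL set, which is how local smallness is rendered. Operations are only
  constrained on the carriers, as in HOL-Algebra. In \<open>Comp C g f\<close> the arrow \<open>f\<close> comes first.
\<close>

record ('o, 'm) category =
  Ob :: "'o set"
  Arr :: "'m set"
  Dom :: "'m \<Rightarrow> 'o"
  Cod :: "'m \<Rightarrow> 'o"
  Id :: "'o \<Rightarrow> 'm"
  Comp :: "'m \<Rightarrow> 'm \<Rightarrow> 'm"  (infixl "\<cdot>\<index>" 70)

definition hom :: "('o, 'm) category \<Rightarrow> 'o \<Rightarrow> 'o \<Rightarrow> 'm set" where
  "hom C x y = {f \<in> Arr C. Dom C f = x \<and> Cod C f = y}"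

locale category =
  fixes C :: "('o, 'm) category" (structure)
  assumes dom_closed: "f \<in> Arr C \<Longrightarrow> Dom C f \<in> Ob C"
    and cod_closed: "f \<in> Arr C \<Longrightarrow> Cod C f \<in> Ob C"
    and id_in_hom: "x \<in> Ob C \<Longrightarrow> Id C x \<in> hom C x x"
    and comp_in_hom: "f \<in> hom C x y \<Longrightarrow> g \<in> hom C y z \<Longrightarrow> g \<cdot> f \<in> hom C x z"
    and comp_id_right: "f \<in> hom C x y \<Longrightarrow> f \<cdot> Id C x = f"
    and comp_id_left: "f \<in> hom C x y \<Longrightarrow> Id C y \<cdot> f = f"
    and comp_assoc: "f \<in> hom C w x \<Longrightarrow> g \<in> hom C x y \<Longrightarrow> h \<in> hom C y z \<Longrightarrow>
          (h \<cdot> g) \<cdot> f = h \<cdot> (g \<cdot> f)"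

definition iso :: "('o, 'm) category \<Rightarrow> 'o \<Rightarrow> 'o \<Rightarrow> 'm \<Rightarrow> bool" where
  "iso C x y f \<longleftrightarrow> f \<in> hom C x y \<and>
     (\<exists>g \<in> hom C y x. Comp C g f = Id C x \<and> Comp C f g = Id C y)"

locale subcategory = A: category A + K: category K
  for A K :: "('o, 'm) category" +
  assumes Ob_subset: "Ob A \<subseteq> Ob K"
    and Arr_subset: "Arr A \<subseteq> Arr K"
    and Dom_eq: "f \<in> Arr A \<Longrightarrow> Dom A f = Dom K f"
    and Cod_eq: "f \<in> Arr A \<Longrightarrow> Cod A f = Cod K f"
    and Id_eq: "x \<in> Ob A \<Longrightarrow> Id A x = Id K x"
    and Comp_eq: "f \<in> hom A x y \<Longrightarrow> g \<in> hom A y z \<Longrightarrow> Comp A g f = Comp K g f"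

locale replete_subcategory = subcategory A K
  for A K :: "('o, 'm) category" +
  assumes iso_closed: "x \<in> Ob A \<Longrightarrow> y \<in> Ob K \<Longrightarrow> iso K x y f \<Longrightarrow> y \<in> Ob A \<and> f \<in> Arr A"

locale full_subcategory = subcategory A K
  for A K :: "('o, 'm) category" +
  assumes full: "x \<in> Ob A \<Longrightarrow> y \<in> Ob A \<Longrightarrow> hom A x y = hom K x y"

record ('o1, 'm1, 'o2, 'm2) functor_data =
  obj_map :: "'o1 \<Rightarrow> 'o2"
  arr_map :: "'m1 \<Rightarrow> 'm2"

locale cat_functor = C: category C + D: category D
  for C :: "('o1, 'm1) category" and D :: "('o2, 'm2) category" +
  fixes F :: "('o1, 'm1, 'o2, 'm2) functor_data"
  assumes obj_map_closed: "x \<in> Ob C \<Longrightarrow> obj_map F x \<in> Ob D"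
    and arr_map_in_hom: "f \<in> hom C x y \<Longrightarrow> arr_map F f \<in> hom D (obj_map F x) (obj_map F y)"
    and map_id: "x \<in> Ob C \<Longrightarrow> arr_map F (Id C x) = Id D (obj_map F x)"
    and map_comp: "f \<in> hom C x y \<Longrightarrow> g \<in> hom C y z \<Longrightarrow>
          arr_map F (Comp C g f) = Comp D (arr_map F g) (arr_map F f)"

definition comp_functor ::
  "('o2, 'm2, 'o3, 'm3) functor_data \<Rightarrow> ('o1, 'm1, 'o2, 'm2) functor_data \<Rightarrow>
   ('o1, 'm1, 'o3, 'm3) functor_data"  (infixr "\<circ>\<^sub>F" 55) where
  "G \<circ>\<^sub>F F = \<lparr>obj_map = obj_map G \<circ> obj_map F, arr_map = arr_map G \<circ> arr_map F\<rparr>"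

definition inclusion :: "('o, 'm) category \<Rightarrow> ('o, 'm, 'o, 'm) functor_data" where
  "inclusion A = \<lparr>obj_map = (\<lambda>x \<in> Ob A. x), arr_map = (\<lambda>f \<in> Arr A. f)\<rparr>"

definition maps_into_itself ::
  "('o, 'm, 'o, 'm) functor_data \<Rightarrow> ('o, 'm) category \<Rightarrow> bool" where
  "maps_into_itself F A \<longleftrightarrow> obj_map F ` Ob A \<subseteq> Ob A \<and> arr_map F ` Arr A \<subseteq> Arr A"

definition restrict_functor ::
  "('o1, 'm1, 'o2, 'm2) functor_data \<Rightarrow> ('o1, 'm1) category \<Rightarrow>
   ('o1, 'm1, 'o2, 'm2) functor_data" where
  "restrict_functor F A =
     \<lparr>obj_map = restrict (obj_map F) (Ob A), arr_map = restrict (arr_map F) (Arr A)\<rparr>"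

locale nat_transformation = F: cat_functor C D F + G: cat_functor C D G
  for C :: "('o1, 'm1) category" and D :: "('o2, 'm2) category" and F G +
  fixes \<tau> :: "'o1 \<Rightarrow> 'm2"
  assumes component_in_hom: "x \<in> Ob C \<Longrightarrow> \<tau> x \<in> hom D (obj_map F x) (obj_map G x)"
    and naturality: "f \<in> hom C x y \<Longrightarrow>
          Comp D (\<tau> y) (arr_map F f) = Comp D (arr_map G f) (\<tau> x)"

locale nat_isomorphism = nat_transformation C D F G \<tau>
  for C :: "('o1, 'm1) category" and D :: "('o2, 'm2) category" and F G \<tau> +
  assumes component_iso: "x \<in> Ob C \<Longrightarrow> iso D (obj_map F x) (obj_map G x) (\<tau> x)"

definition naturally_isomorphic ::
  "('o1, 'm1) category \<Rightarrow> ('o2, 'm2) category \<Rightarrow>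
   ('o1, 'm1, 'o2, 'm2) functor_data \<Rightarrow> ('o1, 'm1, 'o2, 'm2) functor_data \<Rightarrow> bool" where
  "naturally_isomorphic C D F G \<longleftrightarrow> (\<exists>\<tau>. nat_isomorphism C D F G \<tau>)"

text \<open>
  An adjunction is a family of bijections \<open>hom D (F c) d \<rightarrow> hom C c (G d)\<close>;
  the single equation below expresses naturality in \<open>c\<close> and \<open>d\<close> simultaneously.
\<close>

locale adjunction = F: cat_functor C D F + G: cat_functor D C G
  for C :: "('o1, 'm1) category" and D :: "('o2, 'm2) category" and F G +
  fixes \<phi> :: "'o1 \<Rightarrow> 'o2 \<Rightarrow> 'm2 \<Rightarrow> 'm1"
  assumes hom_bij: "c \<in> Ob C \<Longrightarrow> d \<in> Ob D \<Longrightarrow>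
          bij_betw (\<phi> c d) (hom D (obj_map F c) d) (hom C c (obj_map G d))"
    and hom_natural: "h \<in> hom C c' c \<Longrightarrow> k \<in> hom D d d' \<Longrightarrow> f \<in> hom D (obj_map F c) d \<Longrightarrow>
          \<phi> c' d' (Comp D k (Comp D f (arr_map F h))) =
          Comp C (arr_map G k) (Comp C (\<phi> c d f) h)"

definition left_adjoint ::
  "('o1, 'm1) category \<Rightarrow> ('o2, 'm2) category \<Rightarrow>
   ('o1, 'm1, 'o2, 'm2) functor_data \<Rightarrow> ('o2, 'm2, 'o1, 'm1) functor_data \<Rightarrow> bool" where
  "left_adjoint C D F G \<longleftrightarrow> (\<exists>\<phi>. adjunction C D F G \<phi>)"

definition reflection ::
  "('o, 'm) category \<Rightarrow> ('o, 'm) category \<Rightarrow> ('o, 'm, 'o, 'm) functor_data \<Rightarrow> bool" where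
  "reflection A K R \<longleftrightarrow> left_adjoint K A R (inclusion A)"

lemma (in subcategory) inclusion_functor: "cat_functor A K (inclusion A)"
proof unfold_locales
  fix f x y assume "f \<in> hom A x y"
  then show "arr_map (inclusion A) f \<in> hom K (obj_map (inclusion A) x) (obj_map (inclusion A) y)"
    using Arr_subset Dom_eq Cod_eq A.dom_closed A.cod_closed
    by (auto simp: inclusion_def hom_def)
next
  fix f g x y z assume f: "f \<in> hom A x y" and g: "g \<in> hom A y z"
  with A.comp_in_hom[OF f g] Comp_eq[OF f g]
  show "arr_map (inclusion A) (Comp A g f) =
        Comp K (arr_map (inclusion A) g) (arr_map (inclusion A) f)"
    by (auto simp: inclusion_def hom_def)
qed (use Ob_subset Id_eq A.id_in_hom in \<open>auto simp: inclusion_def hom_def\<close>)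

lemma comp_cat_functor:
  assumes "cat_functor C D F" and "cat_functor D E G"
  shows "cat_functor C E (G \<circ>\<^sub>F F)"
proof -
  interpret F: cat_functor C D F by fact
  interpret G: cat_functor D E G by fact
  show ?thesis
  proof unfold_locales
    fix f g x y z assume f: "f \<in> hom C x y" and g: "g \<in> hom C y z"
    show "arr_map (G \<circ>\<^sub>F F) (Comp C g f) = Comp E (arr_map (G \<circ>\<^sub>F F) g) (arr_map (G \<circ>\<^sub>F F) f)"
      using F.map_comp[OF f g] G.map_comp[OF F.arr_map_in_hom[OF f] F.arr_map_in_hom[OF g]]
      by (simp add: comp_functor_def)
  qed (auto simp: comp_functor_def F.obj_map_closed G.obj_map_closed F.map_id G.map_id
         intro: F.arr_map_in_hom G.arr_map_in_hom)
qed

end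

(*
  An arrow m is orthogonal to an object z when precomposition with m is a bijection on arrows into z.
  The unit arrows are orthogonal to every object of the reflective subcategory A, and an object
  orthogonal to all units lies in A. Transposition along the adjunction shows that F m is orthogonal
  to z iff m is orthogonal to G z.

  If F and G preserve A, then F (unit X) is again orthogonal to all objects of A, so it is another
  reflection of F X, and the comparison R (F X) -> F (R X) is invertible.
  Conversely, R inverts the units, hence so does F R, hence so does R F along any natural isomorphism,
  whatever its components are. Thus F (unit X) is orthogonal to A, so G maps A into objects orthogonal
  to all units.
*)
theory Submission imports Defs begin

section \<open>Arrows orthogonal to objects\<close>

lemma homD:
  assumes "f \<in> hom C x y"
  shows "f \<in> Arr C" "Dom C f = x" "Cod C f = y"
  using assms by (auto simp: hom_def)

lemma (in category) hom_Ob: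
  assumes "f \<in> hom C x y"
  shows "x \<in> Ob C" "y \<in> Ob C"
  using homD[OF assms] dom_closed cod_closed by blast+

text \<open>The usual notion of \<open>z\<close> being local with respect to \<open>m\<close>. The
  endpoints are read off \<open>m\<close> itself, so no objects have to be passed along;
  \<open>orthogonal_iff\<close> restores them once \<open>m\<close> is typed.\<close>

definition orthogonal :: "('o, 'm) category \<Rightarrow> 'm \<Rightarrow> 'o \<Rightarrow> bool" where
  "orthogonal C m z \<longleftrightarrow> bij_betw (\<lambda>g. Comp C g m) (hom C (Cod C m) z) (hom C (Dom C m) z)"

lemma orthogonal_iff:
  assumes "m \<in> hom C x y"
  shows "orthogonal C m z \<longleftrightarrow> bij_betw (\<lambda>g. Comp C g m) (hom C y z) (hom C x z)"
  using homD[OF assms] by (simp add: orthogonal_def)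

lemma orthogonal_factor:
  assumes "m \<in> hom C x y" "orthogonal C m z" "f \<in> hom C x z"
  obtains g where "g \<in> hom C y z" "Comp C g m = f"
proof -
  have "f \<in> (\<lambda>g. Comp C g m) ` hom C y z"
    using assms(2,3) by (simp add: orthogonal_iff[OF assms(1)] bij_betw_def)
  then show thesis
    using that by auto
qed

lemma orthogonal_unique:
  assumes "m \<in> hom C x y" "orthogonal C m z" "g \<in> hom C y z" "h \<in> hom C y z"
    "Comp C g m = Comp C h m"
  shows "g = h"
proof -
  have "inj_on (\<lambda>g. Comp C g m) (hom C y z)"
    using assms(2) by (simp add: orthogonal_iff[OF assms(1)] bij_betw_def)
  then show ?thesis
    using assms(3-5) by (simp add: inj_on_def)
qed

context category
begin

lemma iso_inverse:
  assumes "iso C x y f"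
  obtains g where "iso C y x g" "g \<cdot> f = Id C x" "f \<cdot> g = Id C y"
  using assms by (auto simp: iso_def)

lemma orthogonal_comp_iff:
  assumes m: "m \<in> hom C x y" and n: "n \<in> hom C y w"
  shows "orthogonal C (n \<cdot> m) z \<longleftrightarrow>
    bij_betw ((\<lambda>g. g \<cdot> m) \<circ> (\<lambda>g. g \<cdot> n)) (hom C w z) (hom C x z)"
  unfolding orthogonal_iff[OF comp_in_hom[OF m n]]
  by (rule bij_betw_cong) (simp add: comp_assoc[OF m n])

text \<open>Precomposing with \<open>n \<cdot> m\<close> means precomposing with \<open>n\<close>
  first and with \<open>m\<close> second, and a bijection applied first can be cancelled. With the
  next lemma this gives the cancellation used to move orthogonality around commuting
  squares.\<close>

lemma orthogonal_comp_cancel_left: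
  assumes m: "m \<in> hom C x y" and n: "n \<in> hom C y w" and "orthogonal C n z"
  shows "orthogonal C (n \<cdot> m) z \<longleftrightarrow> orthogonal C m z"
  unfolding orthogonal_comp_iff[OF m n] orthogonal_iff[OF m]
  using assms(3) unfolding orthogonal_iff[OF n] by (rule bij_betw_comp_iff[symmetric])

text \<open>Here the known bijection is applied last. Cancelling it requires that precomposition
  with \<open>n\<close> lands in its domain \<open>hom C y z\<close>.\<close>

lemma orthogonal_comp_cancel_right:
  assumes m: "m \<in> hom C x y" and n: "n \<in> hom C y w" and "orthogonal C m z"
  shows "orthogonal C (n \<cdot> m) z \<longleftrightarrow> orthogonal C n z"
proof -
  have "(\<lambda>g. g \<cdot> n) ` hom C w z \<subseteq> hom C y z"
    using comp_in_hom[OF n] by blast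
  with assms(3) show ?thesis
    unfolding orthogonal_comp_iff[OF m n] orthogonal_iff[OF m] orthogonal_iff[OF n]
    by (rule bij_betw_comp_iff2[symmetric])
qed

lemma iso_orthogonal:
  assumes "iso C x y f"
  shows "orthogonal C f z"
proof -
  obtain g where f: "f \<in> hom C x y" and g: "g \<in> hom C y x"
    and gf: "g \<cdot> f = Id C x" and fg: "f \<cdot> g = Id C y"
    using assms by (auto simp: iso_def)
  show ?thesis
    unfolding orthogonal_iff[OF f]
  proof (rule bij_betw_byWitness[where f' = "\<lambda>h. h \<cdot> g"])
    show "\<forall>h\<in>hom C y z. h \<cdot> f \<cdot> g = h"
      using comp_assoc[OF g f] comp_id_right fg by metis
    show "\<forall>h\<in>hom C x z. h \<cdot> g \<cdot> f = h"
      using comp_assoc[OF f g] comp_id_right gf by metis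
  qed (use comp_in_hom f g in blast)+
qed

text \<open>Factoring \<open>Id C x\<close> through \<open>f\<close> yields a left inverse
  \<open>g\<close>. It is also a right inverse, because \<open>f \<cdot> g\<close> and
  \<open>Id C y\<close> agree after precomposition with \<open>f\<close>.\<close>

lemma orthogonal_imp_iso:
  assumes f: "f \<in> hom C x y" and "orthogonal C f x" "orthogonal C f y"
  shows "iso C x y f"
proof -
  have x: "x \<in> Ob C" and y: "y \<in> Ob C"
    using hom_Ob[OF f] .
  obtain g where g: "g \<in> hom C y x" and gf: "g \<cdot> f = Id C x"
    using orthogonal_factor[OF f assms(2) id_in_hom[OF x]] .
  have "(f \<cdot> g) \<cdot> f = Id C y \<cdot> f"
    using comp_assoc[OF f g f] gf comp_id_right[OF f] comp_id_left[OF f] by simp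
  then have "f \<cdot> g = Id C y"
    by (rule orthogonal_unique[OF f assms(3) comp_in_hom[OF g f] id_in_hom[OF y]])
  with f g gf show ?thesis
    by (auto simp: iso_def)
qed

end

section \<open>Functors and transposition along an adjunction\<close>

lemma (in cat_functor) map_iso:
  assumes "iso C x y f"
  shows "iso D (obj_map F x) (obj_map F y) (arr_map F f)"
proof -
  obtain g where f: "f \<in> hom C x y" and g: "g \<in> hom C y x"
    and "Comp C g f = Id C x" "Comp C f g = Id C y"
    using assms by (auto simp: iso_def)
  then show ?thesis
    unfolding iso_def
    using map_comp[OF f g] map_comp[OF g f] map_id C.hom_Ob[OF f]
      arr_map_in_hom[OF f] arr_map_in_hom[OF g] by auto
qed

context adjunction
begin

lemma transpose_in_hom:
  assumes "c \<in> Ob C" "d \<in> Ob D" "f \<in> hom D (obj_map F c) d"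
  shows "\<phi> c d f \<in> hom C c (obj_map G d)"
  using hom_bij[OF assms(1,2)] assms(3) by (auto simp: bij_betw_def)

lemma transpose_comp_left:
  assumes h: "h \<in> hom C c' c" and f: "f \<in> hom D (obj_map F c) d"
  shows "\<phi> c' d (Comp D f (arr_map F h)) = Comp C (\<phi> c d f) h"
proof -
  have d: "d \<in> Ob D" and c: "c \<in> Ob C"
    using F.D.hom_Ob[OF f] F.C.hom_Ob[OF h] by auto
  have "Comp D (Id D d) (Comp D f (arr_map F h)) = Comp D f (arr_map F h)"
    using F.D.comp_id_left F.D.comp_in_hom F.arr_map_in_hom[OF h] f by metis
  moreover have "Comp C (arr_map G (Id D d)) (Comp C (\<phi> c d f) h) = Comp C (\<phi> c d f) h"
    using F.C.comp_id_left F.C.comp_in_hom[OF h transpose_in_hom[OF c d f]] G.map_id[OF d] by metis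
  ultimately show ?thesis
    using hom_natural[OF h F.D.id_in_hom[OF d] f] by simp
qed

lemma transpose_comp_right:
  assumes f: "f \<in> hom D (obj_map F c) d" and k: "k \<in> hom D d d'" and c: "c \<in> Ob C"
  shows "\<phi> c d' (Comp D k f) = Comp C (arr_map G k) (\<phi> c d f)"
proof -
  have d: "d \<in> Ob D"
    using F.D.hom_Ob[OF f] by auto
  show ?thesis
    using hom_natural[OF F.C.id_in_hom[OF c] k f] F.map_id[OF c] F.D.comp_id_right[OF f]
      F.C.comp_id_right[OF transpose_in_hom[OF c d f]] by simp
qed

text \<open>By naturality in the first argument, \<open>\<phi> x z\<close> after precomposition with
  \<open>F m\<close> equals precomposition with \<open>m\<close> after \<open>\<phi> y z\<close>.
  Both transpositions are bijections, so the two precompositions are bijective together.\<close>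

lemma orthogonal_transpose:
  assumes m: "m \<in> hom C x y" and z: "z \<in> Ob D"
  shows "orthogonal D (arr_map F m) z \<longleftrightarrow> orthogonal C m (obj_map G z)"
proof -
  note Fm = F.arr_map_in_hom[OF m]
  have x: "x \<in> Ob C" and y: "y \<in> Ob C"
    using F.C.hom_Ob[OF m] .
  let ?pre = "\<lambda>g. Comp D g (arr_map F m)"
  have "?pre ` hom D (obj_map F y) z \<subseteq> hom D (obj_map F x) z"
    using F.D.comp_in_hom[OF Fm] by blast
  then have "orthogonal D (arr_map F m) z \<longleftrightarrow>
      bij_betw (\<phi> x z \<circ> ?pre) (hom D (obj_map F y) z) (hom C x (obj_map G z))"
    unfolding orthogonal_iff[OF Fm] by (rule bij_betw_comp_iff2[OF hom_bij[OF x z]])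
  also have "\<dots> \<longleftrightarrow> bij_betw ((\<lambda>g. Comp C g m) \<circ> \<phi> y z)
      (hom D (obj_map F y) z) (hom C x (obj_map G z))"
    by (rule bij_betw_cong) (simp add: transpose_comp_left[OF m])
  also have "\<dots> \<longleftrightarrow> orthogonal C m (obj_map G z)"
    unfolding orthogonal_iff[OF m] by (rule bij_betw_comp_iff[OF hom_bij[OF y z], symmetric])
  finally show ?thesis .
qed

end

section \<open>Restriction of functors and adjunctions to a full subcategory\<close>

lemma (in subcategory) hom_subset:
  assumes "f \<in> hom A x y"
  shows "f \<in> hom K x y"
  using homD[OF assms] Dom_eq[of f] Cod_eq[of f] Arr_subset by (auto simp: hom_def)

text \<open>Fullness makes the condition on arrows follow from the one on objects.\<close>

lemma (in full_subcategory) maps_into_itself_iff: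
  assumes "cat_functor K K F"
  shows "maps_into_itself F A \<longleftrightarrow> (\<forall>x\<in>Ob A. obj_map F x \<in> Ob A)"
proof -
  interpret F: cat_functor K K F by fact
  have "arr_map F f \<in> Arr A" if ob: "\<forall>x\<in>Ob A. obj_map F x \<in> Ob A" and f: "f \<in> Arr A" for f
  proof -
    have x: "Dom A f \<in> Ob A" and y: "Cod A f \<in> Ob A"
      using f A.dom_closed A.cod_closed by auto
    have "f \<in> hom K (Dom A f) (Cod A f)"
      using f hom_subset by (simp add: hom_def)
    from F.arr_map_in_hom[OF this]
    have "arr_map F f \<in> hom A (obj_map F (Dom A f)) (obj_map F (Cod A f))"
      using full[of "obj_map F (Dom A f)" "obj_map F (Cod A f)"] ob x y by simp
    then show ?thesis
      by (rule homD(1))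
  qed
  then show ?thesis
    by (auto simp: maps_into_itself_def)
qed

lemma (in full_subcategory) restrict_cat_functor:
  assumes "cat_functor K K F" and inv: "maps_into_itself F A"
  shows "cat_functor A A (restrict_functor F A)"
proof -
  interpret F: cat_functor K K F by fact
  have ob: "obj_map F x \<in> Ob A" if "x \<in> Ob A" for x
    using inv that by (auto simp: maps_into_itself_def)
  have arr: "arr_map F f \<in> hom A (obj_map F x) (obj_map F y)" if "f \<in> hom A x y" for f x y
    using F.arr_map_in_hom[OF hom_subset[OF that]] full[OF ob[OF A.hom_Ob(1)[OF that]]
        ob[OF A.hom_Ob(2)[OF that]]] by simp
  show ?thesis
  proof unfold_locales
    fix f x y assume f: "f \<in> hom A x y"
    then show "arr_map (restrict_functor F A) f \<in>
        hom A (obj_map (restrict_functor F A) x) (obj_map (restrict_functor F A) y)"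
      using arr[OF f] A.hom_Ob[OF f] homD(1)[OF f] by (simp add: restrict_functor_def)
  next
    fix x assume x: "x \<in> Ob A"
    then have "arr_map F (Id A x) = Id A (obj_map F x)"
      using F.map_id[of x] Id_eq[OF x] Id_eq[OF ob[OF x]] Ob_subset by auto
    with x show "arr_map (restrict_functor F A) (Id A x) = Id A (obj_map (restrict_functor F A) x)"
      using homD(1)[OF A.id_in_hom[OF x]] by (simp add: restrict_functor_def)
  next
    fix f g x y z assume f: "f \<in> hom A x y" and g: "g \<in> hom A y z"
    have "arr_map F (Comp A g f) = Comp A (arr_map F g) (arr_map F f)"
      using F.map_comp[OF hom_subset[OF f] hom_subset[OF g]] Comp_eq[OF f g]
        Comp_eq[OF arr[OF f] arr[OF g]] by simp
    then show "arr_map (restrict_functor F A) (Comp A g f) =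
        Comp A (arr_map (restrict_functor F A) g) (arr_map (restrict_functor F A) f)"
      using homD(1)[OF f] homD(1)[OF g] homD(1)[OF A.comp_in_hom[OF f g]]
      by (simp add: restrict_functor_def)
  qed (simp add: restrict_functor_def ob)
qed

lemma (in full_subcategory) restrict_left_adjoint:
  assumes "left_adjoint K K F G" and F: "maps_into_itself F A" and G: "maps_into_itself G A"
  shows "left_adjoint A A (restrict_functor F A) (restrict_functor G A)"
proof -
  obtain \<phi> where "adjunction K K F G \<phi>"
    using assms(1) by (auto simp: left_adjoint_def)
  then interpret adj: adjunction K K F G \<phi> .
  interpret FA: cat_functor A A "restrict_functor F A"
    using restrict_cat_functor[OF adj.F.cat_functor_axioms F] .
  interpret GA: cat_functor A A "restrict_functor G A"
    using restrict_cat_functor[OF adj.G.cat_functor_axioms G] .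
  have FG: "obj_map F x \<in> Ob A" "obj_map G x \<in> Ob A" if "x \<in> Ob A" for x
    using F G that by (auto simp: maps_into_itself_def)
  \<comment> \<open>The same transposition serves: by fullness the homs involved are homs of
    \<open>K\<close>, and every composite occurring in the naturality equation is formed from arrows
    of \<open>A\<close>.\<close>
  have "adjunction A A (restrict_functor F A) (restrict_functor G A) \<phi>"
  proof unfold_locales
    fix c d assume c: "c \<in> Ob A" and d: "d \<in> Ob A"
    then show "bij_betw (\<phi> c d) (hom A (obj_map (restrict_functor F A) c) d)
        (hom A c (obj_map (restrict_functor G A) d))"
      using adj.hom_bij[of c d] Ob_subset full FG by (auto simp: restrict_functor_def)
  next
    fix h c' c k d d' f
    assume h: "h \<in> hom A c' c" and k: "k \<in> hom A d d'"
      and f0: "f \<in> hom A (obj_map (restrict_functor F A) c) d"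
    note ob = A.hom_Ob[OF h] A.hom_Ob[OF k]
    have f: "f \<in> hom A (obj_map F c) d"
      using f0 ob by (simp add: restrict_functor_def)
    have hK: "h \<in> hom K c' c" and kK: "k \<in> hom K d d'" and fK: "f \<in> hom K (obj_map F c) d"
      using hom_subset h k f by blast+
    have Fh: "arr_map F h \<in> hom A (obj_map F c') (obj_map F c)"
      using adj.F.arr_map_in_hom[OF hK] full[OF FG(1) FG(1)] ob by blast
    have Gk: "arr_map G k \<in> hom A (obj_map G d) (obj_map G d')"
      using adj.G.arr_map_in_hom[OF kK] full[OF FG(2) FG(2)] ob by blast
    have \<phi>f: "\<phi> c d f \<in> hom A c (obj_map G d)"
      using adj.transpose_in_hom[OF _ _ fK] full[OF _ FG(2)] ob Ob_subset by blast
    show "\<phi> c' d' (Comp A k (Comp A f (arr_map (restrict_functor F A) h))) =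
        Comp A (arr_map (restrict_functor G A) k) (Comp A (\<phi> c d f) h)"
      using adj.hom_natural[OF hK kK fK] homD(1)[OF h] homD(1)[OF k]
        Comp_eq[OF Fh f] Comp_eq[OF A.comp_in_hom[OF Fh f] k]
        Comp_eq[OF h \<phi>f] Comp_eq[OF A.comp_in_hom[OF h \<phi>f] Gk]
      by (simp add: restrict_functor_def)
  qed
  then show ?thesis
    by (auto simp: left_adjoint_def)
qed

section \<open>The unit of the reflection\<close>

locale reflective_subcategory =
  replete_subcategory A K + full_subcategory A K + refl: adjunction K A R "inclusion A" \<rho>
  for A K :: "('o, 'm) category" and R :: "('o, 'm, 'o, 'm) functor_data"
    and \<rho> :: "'o \<Rightarrow> 'o \<Rightarrow> 'm \<Rightarrow> 'm"
begin

definition unit :: "'o \<Rightarrow> 'm" where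
  "unit x = \<rho> x (obj_map R x) (Id A (obj_map R x))"

lemma R_in_hom:
  assumes "f \<in> hom K x y"
  shows "arr_map R f \<in> hom K (obj_map R x) (obj_map R y)"
  using assms refl.F.arr_map_in_hom refl.F.obj_map_closed full K.hom_Ob by metis

lemma unit_in_hom:
  assumes "x \<in> Ob K"
  shows "unit x \<in> hom K x (obj_map R x)"
  using refl.transpose_in_hom[OF assms refl.F.obj_map_closed[OF assms]
      A.id_in_hom[OF refl.F.obj_map_closed[OF assms]]] refl.F.obj_map_closed[OF assms]
  by (simp add: unit_def inclusion_def)

text \<open>Naturality of \<open>\<rho>\<close> applied to \<open>f\<close> composed with the
  identity of \<open>R x\<close>. This identifies the abstract transposition with precomposition by
  the unit.\<close>

lemma transpose_eq_comp_unit: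
  assumes x: "x \<in> Ob K" and f: "f \<in> hom A (obj_map R x) a"
  shows "\<rho> x a f = Comp K f (unit x)"
  using refl.transpose_comp_right[OF A.id_in_hom[OF refl.F.obj_map_closed[OF x]] f x]
    A.comp_id_right[OF f] homD(1)[OF f] by (simp add: unit_def inclusion_def)

lemma unit_orthogonal:
  assumes x: "x \<in> Ob K" and a: "a \<in> Ob A"
  shows "orthogonal K (unit x) a"
proof -
  have "bij_betw (\<rho> x a) (hom A (obj_map R x) a) (hom K x a)"
    using refl.hom_bij[OF x a] a by (simp add: inclusion_def)
  moreover have "bij_betw (\<rho> x a) (hom A (obj_map R x) a) (hom K x a) \<longleftrightarrow>
      bij_betw (\<lambda>g. Comp K g (unit x)) (hom A (obj_map R x) a) (hom K x a)"
    by (rule bij_betw_cong) (rule transpose_eq_comp_unit[OF x])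
  ultimately show ?thesis
    unfolding orthogonal_iff[OF unit_in_hom[OF x]] full[OF refl.F.obj_map_closed[OF x] a] by simp
qed

text \<open>Both sides are the transpose of \<open>R h\<close>, once by
  \<open>transpose_eq_comp_unit\<close> and once by naturality in the first argument.\<close>

lemma unit_natural:
  assumes h: "h \<in> hom K x y"
  shows "Comp K (arr_map R h) (unit x) = Comp K (unit y) h"
proof -
  have x: "x \<in> Ob K" and y: "y \<in> Ob K"
    using K.hom_Ob[OF h] .
  have Rh: "arr_map R h \<in> hom A (obj_map R x) (obj_map R y)"
    using refl.F.arr_map_in_hom[OF h] .
  show ?thesis
    using refl.transpose_comp_left[OF h A.id_in_hom[OF refl.F.obj_map_closed[OF y]]]
      A.comp_id_left[OF Rh] transpose_eq_comp_unit[OF x Rh] by (simp add: unit_def)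
qed

text \<open>Both ends of this unit lie in \<open>A\<close>, and units are orthogonal to all objects
  of \<open>A\<close>.\<close>

lemma unit_iso:
  assumes "a \<in> Ob A"
  shows "iso K a (obj_map R a) (unit a)"
proof -
  have a: "a \<in> Ob K"
    using assms Ob_subset by blast
  show ?thesis
    by (rule K.orthogonal_imp_iso[OF unit_in_hom[OF a] unit_orthogonal[OF a assms]
          unit_orthogonal[OF a refl.F.obj_map_closed[OF a]]])
qed

text \<open>Naturality of the unit at the arrow \<open>unit x\<close> itself shows that
  \<open>R (unit x)\<close> and \<open>unit (R x)\<close> agree after precomposition with
  \<open>unit x\<close>. Hence they are equal, and the latter is invertible since \<open>R x\<close>
  lies in \<open>A\<close>.\<close>

lemma R_unit_iso:
  assumes x: "x \<in> Ob K"
  shows "iso K (obj_map R x) (obj_map R (obj_map R x)) (arr_map R (unit x))"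
proof -
  note u = unit_in_hom[OF x]
  have Rx: "obj_map R x \<in> Ob A"
    using refl.F.obj_map_closed[OF x] .
  then have RxK: "obj_map R x \<in> Ob K"
    using Ob_subset by blast
  have "arr_map R (unit x) = unit (obj_map R x)"
    using orthogonal_unique[OF u unit_orthogonal[OF x refl.F.obj_map_closed[OF RxK]]
        R_in_hom[OF u] unit_in_hom[OF RxK]] unit_natural[OF u] by simp
  then show ?thesis
    using unit_iso[OF Rx] by simp
qed

lemma in_subcategory_if_orthogonal_unit:
  assumes z: "z \<in> Ob K" and orth: "orthogonal K (unit z) z"
  shows "z \<in> Ob A"
proof -
  have Rz: "obj_map R z \<in> Ob A"
    using refl.F.obj_map_closed[OF z] .
  have "iso K z (obj_map R z) (unit z)"
    using K.orthogonal_imp_iso[OF unit_in_hom[OF z] orth unit_orthogonal[OF z Rz]] .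
  \<comment> \<open>Repleteness transports membership from source to target, so the isomorphism has
    to start at \<open>R z\<close>.\<close>
  then obtain g where "iso K (obj_map R z) z g"
    by (rule K.iso_inverse)
  then show ?thesis
    using iso_closed[OF Rz z] by simp
qed

section \<open>Comparing \<open>R\<close> after \<open>F\<close> with \<open>F\<close> after
  \<open>R\<close>\<close>

lemma inclusion_R_maps:
  assumes "cat_functor K K F"
  shows "x \<in> Ob K \<Longrightarrow> obj_map (inclusion A \<circ>\<^sub>F R \<circ>\<^sub>F F) x = obj_map R (obj_map F x)"
    and "f \<in> hom K x y \<Longrightarrow> arr_map (inclusion A \<circ>\<^sub>F R \<circ>\<^sub>F F) f = arr_map R (arr_map F f)"
    and "x \<in> Ob K \<Longrightarrow> obj_map (F \<circ>\<^sub>F inclusion A \<circ>\<^sub>F R) x = obj_map F (obj_map R x)"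
    and "f \<in> hom K x y \<Longrightarrow> arr_map (F \<circ>\<^sub>F inclusion A \<circ>\<^sub>F R) f = arr_map F (arr_map R f)"
proof -
  interpret F: cat_functor K K F by fact
  \<comment> \<open>The inclusion consists of restricted functions, so it returns its argument only
    once that is known to lie in \<open>A\<close>; values of \<open>R\<close> do.\<close>
  note Ob = refl.F.obj_map_closed and Ar = homD(1)[OF refl.F.arr_map_in_hom]
  show "x \<in> Ob K \<Longrightarrow> obj_map (inclusion A \<circ>\<^sub>F R \<circ>\<^sub>F F) x = obj_map R (obj_map F x)"
    "x \<in> Ob K \<Longrightarrow> obj_map (F \<circ>\<^sub>F inclusion A \<circ>\<^sub>F R) x = obj_map F (obj_map R x)"
    using Ob F.obj_map_closed by (simp_all add: comp_functor_def inclusion_def)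
  show "f \<in> hom K x y \<Longrightarrow> arr_map (inclusion A \<circ>\<^sub>F R \<circ>\<^sub>F F) f = arr_map R (arr_map F f)"
    "f \<in> hom K x y \<Longrightarrow> arr_map (F \<circ>\<^sub>F inclusion A \<circ>\<^sub>F R) f = arr_map F (arr_map R f)"
    using Ar[of f x y] Ar[OF F.arr_map_in_hom[of f x y]]
    by (simp_all add: comp_functor_def inclusion_def)
qed

lemma inclusion_R_cat_functors:
  assumes "cat_functor K K F"
  shows "cat_functor K K (inclusion A \<circ>\<^sub>F R \<circ>\<^sub>F F)" "cat_functor K K (F \<circ>\<^sub>F inclusion A \<circ>\<^sub>F R)"
proof -
  have R: "cat_functor K K (inclusion A \<circ>\<^sub>F R)"
    using comp_cat_functor[OF refl.F.cat_functor_axioms inclusion_functor] .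
  show "cat_functor K K (F \<circ>\<^sub>F inclusion A \<circ>\<^sub>F R)"
    using comp_cat_functor[OF R assms] .
  show "cat_functor K K (inclusion A \<circ>\<^sub>F R \<circ>\<^sub>F F)"
    using comp_cat_functor[OF comp_cat_functor[OF assms refl.F.cat_functor_axioms]
        inclusion_functor] .
qed

lemma naturally_isomorphic_if_invariant:
  assumes "adjunction K K F G \<phi>"
    and FA: "\<And>a. a \<in> Ob A \<Longrightarrow> obj_map F a \<in> Ob A"
    and GA: "\<And>a. a \<in> Ob A \<Longrightarrow> obj_map G a \<in> Ob A"
  shows "naturally_isomorphic K K (inclusion A \<circ>\<^sub>F R \<circ>\<^sub>F F) (F \<circ>\<^sub>F inclusion A \<circ>\<^sub>F R)"
proof -
  interpret adj: adjunction K K F G \<phi> by fact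
  let ?F = "obj_map F" and ?R = "obj_map R" and ?u = "\<lambda>x. unit (obj_map F x)"
  have FR: "?F (?R x) \<in> Ob A" if "x \<in> Ob K" for x
    using FA[OF refl.F.obj_map_closed[OF that]] .
  have u: "?u x \<in> hom K (?F x) (?R (?F x))" if "x \<in> Ob K" for x
    using unit_in_hom[OF adj.F.obj_map_closed[OF that]] .
  have Fu: "arr_map F (unit x) \<in> hom K (?F x) (?F (?R x))" if "x \<in> Ob K" for x
    using adj.F.arr_map_in_hom[OF unit_in_hom[OF that]] .
  \<comment> \<open>The comparison arrow is the factorization of \<open>F (unit x)\<close> through
    the unit of \<open>F x\<close>; it exists because \<open>F (R x)\<close> lies in
    \<open>A\<close>.\<close>
  have "\<exists>t \<in> hom K (?R (?F x)) (?F (?R x)). Comp K t (?u x) = arr_map F (unit x)"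
    if x: "x \<in> Ob K" for x
    using orthogonal_factor[OF u[OF x] unit_orthogonal[OF adj.F.obj_map_closed[OF x] FR[OF x]] Fu[OF x]]
    by blast
  then obtain \<tau> where \<tau>: "\<And>x. x \<in> Ob K \<Longrightarrow> \<tau> x \<in> hom K (?R (?F x)) (?F (?R x))"
    and \<tau>u: "\<And>x. x \<in> Ob K \<Longrightarrow> Comp K (\<tau> x) (?u x) = arr_map F (unit x)"
    by metis
  have iso: "iso K (?R (?F x)) (?F (?R x)) (\<tau> x)" if x: "x \<in> Ob K" for x
  proof -
    \<comment> \<open>Invariance under \<open>G\<close> enters here: \<open>unit x\<close> is
      orthogonal to \<open>G a\<close>, so \<open>F (unit x)\<close> is orthogonal to
      \<open>a\<close>, and cancelling the unit of \<open>F x\<close> leaves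
      \<open>\<tau> x\<close>. Both ends of \<open>\<tau> x\<close> lie in \<open>A\<close>, so this
      suffices for invertibility.\<close>
    have "orthogonal K (\<tau> x) a" if a: "a \<in> Ob A" for a
    proof -
      have "orthogonal K (arr_map F (unit x)) a"
        using adj.orthogonal_transpose[OF unit_in_hom[OF x]] unit_orthogonal[OF x GA[OF a]]
          subsetD[OF Ob_subset a] by simp
      then show ?thesis
        using K.orthogonal_comp_cancel_right[OF u[OF x] \<tau>[OF x]
            unit_orthogonal[OF adj.F.obj_map_closed[OF x] a]] \<tau>u[OF x] by simp
    qed
    then show ?thesis
      using K.orthogonal_imp_iso[OF \<tau>[OF x]] FR[OF x]
        refl.F.obj_map_closed[OF adj.F.obj_map_closed[OF x]] by simp
  qed
  \<comment> \<open>Both sides go from \<open>R (F x)\<close> to \<open>F (R y)\<close>, which lies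
    in \<open>A\<close>, so it is enough to compare them after precomposition with the unit of
    \<open>F x\<close>.\<close>
  have nat: "Comp K (\<tau> y) (arr_map R (arr_map F f)) = Comp K (arr_map F (arr_map R f)) (\<tau> x)"
    if f: "f \<in> hom K x y" for f x y
  proof -
    have x: "x \<in> Ob K" and y: "y \<in> Ob K"
      using K.hom_Ob[OF f] .
    note Ff = adj.F.arr_map_in_hom[OF f] and Rf = R_in_hom[OF f]
    note RFf = R_in_hom[OF Ff] and FRf = adj.F.arr_map_in_hom[OF Rf]
    have "Comp K (Comp K (\<tau> y) (arr_map R (arr_map F f))) (?u x)
        = Comp K (\<tau> y) (Comp K (?u y) (arr_map F f))"
      using K.comp_assoc[OF u[OF x] RFf \<tau>[OF y]] unit_natural[OF Ff] by simp
    also have "\<dots> = Comp K (arr_map F (unit y)) (arr_map F f)"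
      using K.comp_assoc[OF Ff u[OF y] \<tau>[OF y]] \<tau>u[OF y] by simp
    also have "\<dots> = arr_map F (Comp K (arr_map R f) (unit x))"
      using adj.F.map_comp[OF f unit_in_hom[OF y]] unit_natural[OF f] by simp
    also have "\<dots> = Comp K (arr_map F (arr_map R f)) (Comp K (\<tau> x) (?u x))"
      using adj.F.map_comp[OF unit_in_hom[OF x] Rf] \<tau>u[OF x] by simp
    also have "\<dots> = Comp K (Comp K (arr_map F (arr_map R f)) (\<tau> x)) (?u x)"
      using K.comp_assoc[OF u[OF x] \<tau>[OF x] FRf] by simp
    finally show ?thesis
      by (rule orthogonal_unique[OF u[OF x]
            unit_orthogonal[OF adj.F.obj_map_closed[OF x] FR[OF y]]
            K.comp_in_hom[OF RFf \<tau>[OF y]] K.comp_in_hom[OF \<tau>[OF x] FRf]])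
  qed
  note maps = inclusion_R_maps[OF adj.F.cat_functor_axioms]
  interpret RF: cat_functor K K "inclusion A \<circ>\<^sub>F R \<circ>\<^sub>F F"
    using inclusion_R_cat_functors(1)[OF adj.F.cat_functor_axioms] .
  interpret FR: cat_functor K K "F \<circ>\<^sub>F inclusion A \<circ>\<^sub>F R"
    using inclusion_R_cat_functors(2)[OF adj.F.cat_functor_axioms] .
  have "nat_isomorphism K K (inclusion A \<circ>\<^sub>F R \<circ>\<^sub>F F) (F \<circ>\<^sub>F inclusion A \<circ>\<^sub>F R) \<tau>"
    by unfold_locales (simp_all add: maps \<tau> iso nat)
  then show ?thesis
    by (auto simp: naturally_isomorphic_def)
qed

lemma invariant_if_naturally_isomorphic:
  assumes "adjunction K K F G \<phi>"
    and "naturally_isomorphic K K (inclusion A \<circ>\<^sub>F R \<circ>\<^sub>F F) (F \<circ>\<^sub>F inclusion A \<circ>\<^sub>F R)"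
    and a: "a \<in> Ob A"
  shows "obj_map F a \<in> Ob A" "obj_map G a \<in> Ob A"
proof -
  interpret adj: adjunction K K F G \<phi> by fact
  obtain \<tau> where "nat_isomorphism K K (inclusion A \<circ>\<^sub>F R \<circ>\<^sub>F F) (F \<circ>\<^sub>F inclusion A \<circ>\<^sub>F R) \<tau>"
    using assms(2) by (auto simp: naturally_isomorphic_def)
  then interpret \<tau>: nat_isomorphism K K "inclusion A \<circ>\<^sub>F R \<circ>\<^sub>F F" "F \<circ>\<^sub>F inclusion A \<circ>\<^sub>F R" \<tau> .
  note maps = inclusion_R_maps[OF adj.F.cat_functor_axioms]
  have iso: "iso K (obj_map R (obj_map F x)) (obj_map F (obj_map R x)) (\<tau> x)"
    if "x \<in> Ob K" for x
    using \<tau>.component_iso[OF that] that by (simp add: maps)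
  then have \<tau>: "\<tau> x \<in> hom K (obj_map R (obj_map F x)) (obj_map F (obj_map R x))"
    if "x \<in> Ob K" for x
    using that by (auto simp: iso_def)
  have nat: "Comp K (\<tau> y) (arr_map R (arr_map F f)) = Comp K (arr_map F (arr_map R f)) (\<tau> x)"
    if "f \<in> hom K x y" for f x y
    using \<tau>.naturality[OF that] that by (simp add: maps)
  have aK: "a \<in> Ob K"
    using a Ob_subset by blast

  \<comment> \<open>\<open>F (R a)\<close> is isomorphic to \<open>R (F a)\<close>, hence in
    \<open>A\<close>. It is also isomorphic to \<open>F a\<close>, because \<open>a\<close> is
    isomorphic to \<open>R a\<close>.\<close>
  have FRa: "obj_map F (obj_map R a) \<in> Ob A"
    using iso_closed[OF refl.F.obj_map_closed[OF adj.F.obj_map_closed[OF aK]]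
        K.hom_Ob(2)[OF \<tau>[OF aK]] iso[OF aK]] by simp
  obtain g where "iso K (obj_map F (obj_map R a)) (obj_map F a) g"
    using K.iso_inverse[OF adj.F.map_iso[OF unit_iso[OF a]]] .
  then show "obj_map F a \<in> Ob A"
    using iso_closed[OF FRa adj.F.obj_map_closed[OF aK]] by simp

  \<comment> \<open>The goal is that the unit of \<open>?z\<close> is orthogonal to
    \<open>?z\<close>; by transposition this says that \<open>F (unit ?z)\<close> is orthogonal to
    \<open>a\<close>.\<close>
  let ?z = "obj_map G a"
  have z: "?z \<in> Ob K"
    using adj.G.obj_map_closed[OF aK] .
  note u = unit_in_hom[OF z]
  have Rz: "obj_map R ?z \<in> Ob K"
    using K.hom_Ob(2)[OF u] .
  note Fu = adj.F.arr_map_in_hom[OF u] and FRu = adj.F.arr_map_in_hom[OF R_in_hom[OF u]]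
  note RFu = R_in_hom[OF Fu]
  \<comment> \<open>Both factors are isomorphisms. Naturality of \<open>\<tau>\<close> at
    \<open>unit ?z\<close> rewrites the composite so that the other component of
    \<open>\<tau>\<close> can be cancelled, leaving \<open>R (F (unit ?z))\<close>.\<close>
  have "orthogonal K (Comp K (arr_map F (arr_map R (unit ?z))) (\<tau> ?z)) a"
    using K.orthogonal_comp_cancel_right[OF \<tau>[OF z] FRu] K.iso_orthogonal[OF iso[OF z]]
      K.iso_orthogonal[OF adj.F.map_iso[OF R_unit_iso[OF z]]] by simp
  then have "orthogonal K (arr_map R (arr_map F (unit ?z))) a"
    using K.orthogonal_comp_cancel_left[OF RFu \<tau>[OF Rz]] K.iso_orthogonal[OF iso[OF Rz]]
      nat[OF u] by simp
  \<comment> \<open>The unit square at \<open>F (unit ?z)\<close> removes the outer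
    \<open>R\<close>: the two units in it are orthogonal to \<open>a\<close>, so one is composed on
    the right and the other is then cancelled on the left.\<close>
  then have "orthogonal K (Comp K (unit (obj_map F (obj_map R ?z))) (arr_map F (unit ?z))) a"
    using K.orthogonal_comp_cancel_right[OF unit_in_hom[OF adj.F.obj_map_closed[OF z]] RFu
        unit_orthogonal[OF adj.F.obj_map_closed[OF z] a]] unit_natural[OF Fu] by simp
  then have "orthogonal K (arr_map F (unit ?z)) a"
    using K.orthogonal_comp_cancel_left[OF Fu unit_in_hom[OF adj.F.obj_map_closed[OF Rz]]]
      unit_orthogonal[OF adj.F.obj_map_closed[OF Rz] a] by simp
  then have "orthogonal K (unit ?z) ?z"
    using adj.orthogonal_transpose[OF u aK] by simp
  then show "?z \<in> Ob A"
    by (rule in_subcategory_if_orthogonal_unit[OF z])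
qed

end

theorem propositionB1:
  fixes A K :: "('o, 'm) category"
    and R F G :: "('o, 'm, 'o, 'm) functor_data"
  assumes "replete_subcategory A K"
    and "full_subcategory A K"
    and "reflection A K R"
    and "left_adjoint K K F G"
  shows "((maps_into_itself F A \<and> maps_into_itself G A) \<longleftrightarrow>
           naturally_isomorphic K K (inclusion A \<circ>\<^sub>F R \<circ>\<^sub>F F) (F \<circ>\<^sub>F inclusion A \<circ>\<^sub>F R)) \<and>
         ((maps_into_itself F A \<and> maps_into_itself G A) \<or>
           naturally_isomorphic K K (inclusion A \<circ>\<^sub>F R \<circ>\<^sub>F F) (F \<circ>\<^sub>F inclusion A \<circ>\<^sub>F R) \<longrightarrow>
           left_adjoint A A (restrict_functor F A) (restrict_functor G A))"
proof -
  obtain \<rho> where "adjunction K A R (inclusion A) \<rho>"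
    using assms(3) by (auto simp: reflection_def left_adjoint_def)
  with assms(1,2) interpret reflective_subcategory A K R \<rho>
    by (simp add: reflective_subcategory_def)
  obtain \<phi> where adj: "adjunction K K F G \<phi>"
    using assms(4) by (auto simp: left_adjoint_def)
  then interpret adj: adjunction K K F G \<phi> .
  note invariant_iff = maps_into_itself_iff[OF adj.F.cat_functor_axioms]
    maps_into_itself_iff[OF adj.G.cat_functor_axioms]
  have "(maps_into_itself F A \<and> maps_into_itself G A) \<longleftrightarrow>
      naturally_isomorphic K K (inclusion A \<circ>\<^sub>F R \<circ>\<^sub>F F) (F \<circ>\<^sub>F inclusion A \<circ>\<^sub>F R)"
    using naturally_isomorphic_if_invariant[OF adj] invariant_if_naturally_isomorphic[OF adj]
    unfolding invariant_iff by blast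
  then show ?thesis
    using restrict_left_adjoint[OF assms(4)] by blast
qed

end
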